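(* Let $p\ge2$ and $m\ge0$ be integers. Then \begin{align*} &(-1)^{p-1}\{S(2,p+2m;p)-S(2,p;p+2m)\}\\ &=\sum_{i=1}^{p+2m-1}\sum_{j=1}^{p+2m-i}(-1)^{i+j}\zeta(p+2m+2-i-j)S(p;i+j)-\sum_{i=1}^{p-1}\sum_{j=1}^{p-i}(-1)^{i+j}\zeta(p+2-i-j)S(p+2m;i+j)\\ &\quad-(-1)^{p-1}\zeta(2)\{S(p;p+2m)-S(p+2m;p)\}\\ &\quad+(-1)^{p-1}(p+2m)S(1,p;p+2m+1)-(-1)^{p-1}p\,S(1,p+2m;p+1). \end{align*}
   Context: For positive integers $k,n$, $\zeta_n(k)=\sum_{j=1}^n j^{-k}$, $H_n=\zeta_n(1)$, and $\zeta(s)=\sum_{n\ge1}n^{-s}$. For positive integers $a,b,q$ with $q\ge2$: $S(a;q)=\sum_{n\ge1}\zeta_n(a)n^{-q}$ and $S(a,b;q)=\sum_{n\ge1}\zeta_n(a)\zeta_n(b)n^{-q}$. *)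

theory Defs
  imports "HOL-Analysis.Analysis"
begin

(* suminf ranges over n = 0, 1, 2, ..., so series over n \<ge> 1 are indexed by Suc n.
   suminf is meaningful only for convergent series: s, q \<ge> 2 below. *)

definition zeta :: "nat \<Rightarrow> real" where
  "zeta s = (\<Sum>n. 1 / real (Suc n) ^ s)"

definition zeta_partial :: "nat \<Rightarrow> nat \<Rightarrow> real" where
  "zeta_partial n k = (\<Sum>j=1..n. 1 / real j ^ k)"

definition S_lin :: "nat \<Rightarrow> nat \<Rightarrow> real" where
  "S_lin a q = (\<Sum>n. zeta_partial (Suc n) a / real (Suc n) ^ q)"

definition S_quad :: "nat \<Rightarrow> nat \<Rightarrow> nat \<Rightarrow> real" where
  "S_quad a b q = (\<Sum>n. zeta_partial (Suc n) a * zeta_partial (Suc n) b / real (Suc n) ^ q)"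

end

theory Submission
  imports Defs
begin

text \<open>
  Write \<open>q = p + 2 * m\<close>. By reordering a series of nonnegative terms, the sum over \<open>n\<close> of
  \<open>\<zeta>\<^sub>n(p) * (\<Sum>k\<ge>1. 1 / (k ^ q * (n + k)\<^sup>2))\<close> equals the sum over all \<open>j, k \<ge> 1\<close> of
  \<open>1 / (j ^ p * k ^ q) * (\<Sum>n\<ge>0. 1 / (n + j + k)\<^sup>2)\<close>, which is symmetric in \<open>p\<close> and \<open>q\<close>.
  Expanding \<open>1 / (k ^ q * (n + k)\<^sup>2)\<close> into partial fractions in \<open>k\<close> evaluates the first form in
  terms of Euler sums. Equating this evaluation with the one where \<open>p\<close> and \<open>q\<close> are exchanged gives
  the theorem, since \<open>(-1) ^ p = (-1) ^ q\<close>.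
\<close>

definition shifted_sum :: "nat \<Rightarrow> nat \<Rightarrow> real" where
  "shifted_sum q n = (\<Sum>k. 1 / (real (Suc k) ^ q * real (n + Suc k) ^ 2))"

section \<open>Partial zeta sums and convergence of the Euler sums\<close>

lemma zeta_partial_Suc:
  "zeta_partial (Suc n) k = zeta_partial n k + 1 / real (Suc n) ^ k"
  by (simp add: zeta_partial_def)

lemma zeta_partial_0 [simp]: "zeta_partial 0 k = 0"
  by (simp add: zeta_partial_def)

lemma zeta_partial_nonneg: "0 \<le> zeta_partial n k"
  by (simp add: zeta_partial_def sum_nonneg)

lemma zeta_partial_eq_sum_lessThan: "zeta_partial n k = (\<Sum>j<n. 1 / real (Suc j) ^ k)"
  by (induction n) (simp_all add: zeta_partial_Suc)

lemma zeta_sums: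
  assumes "2 \<le> s"
  shows "(\<lambda>n. 1 / real (Suc n) ^ s) sums zeta s"
proof -
  have "summable (\<lambda>n. inverse (real (Suc n) ^ s))"
    using inverse_power_summable[OF assms, where 'a = real] by (subst summable_Suc_iff)
  then show ?thesis
    unfolding zeta_def by (intro summable_sums) (simp add: inverse_eq_divide)
qed

lemma zeta_partial_le_zeta:
  assumes "2 \<le> k"
  shows "zeta_partial n k \<le> zeta k"
  unfolding zeta_partial_eq_sum_lessThan zeta_def
  by (rule sum_le_suminf) (use zeta_sums[OF assms] in \<open>auto simp: sums_iff\<close>)

lemma zeta_partial_le: "zeta_partial n k \<le> real n"
proof -
  have "1 / real j ^ k \<le> 1" if "j \<in> {1..n}" for j
    using that by (simp add: divide_le_eq)
  then have "zeta_partial n k \<le> (\<Sum>j = 1..n. 1)"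
    unfolding zeta_partial_def by (intro sum_mono) auto
  then show ?thesis by simp
qed

lemma S_lin_sums:
  assumes "2 \<le> a" "2 \<le> q"
  shows "(\<lambda>n. zeta_partial (Suc n) a / real (Suc n) ^ q) sums S_lin a q"
  unfolding S_lin_def
proof (rule summable_sums[OF summable_comparison_test'[where N = 0]])
  show "summable (\<lambda>n. zeta a * (1 / real (Suc n) ^ q))"
    using zeta_sums[OF assms(2)] by (intro summable_mult) (simp add: sums_iff)
  show "norm (zeta_partial (Suc n) a / real (Suc n) ^ q) \<le> zeta a * (1 / real (Suc n) ^ q)" for n
    using zeta_partial_le_zeta[OF assms(1), of "Suc n"] zeta_partial_nonneg[of "Suc n" a]
    by (simp add: divide_right_mono)
qed

lemma S_quad_sums:
  assumes "2 \<le> a" "2 \<le> b" "2 \<le> q"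
  shows "(\<lambda>n. zeta_partial (Suc n) a * zeta_partial (Suc n) b / real (Suc n) ^ q) sums S_quad a b q"
  unfolding S_quad_def
proof (rule summable_sums[OF summable_comparison_test'[where N = 0]])
  show "summable (\<lambda>n. zeta a * zeta b * (1 / real (Suc n) ^ q))"
    using zeta_sums[OF assms(3)] by (intro summable_mult) (simp add: sums_iff)
  show "norm (zeta_partial (Suc n) a * zeta_partial (Suc n) b / real (Suc n) ^ q)
      \<le> zeta a * zeta b * (1 / real (Suc n) ^ q)" for n
    using mult_mono'[OF zeta_partial_le_zeta[OF assms(1), of "Suc n"]
        zeta_partial_le_zeta[OF assms(2), of "Suc n"]]
    by (simp add: divide_right_mono zeta_partial_nonneg abs_mult)
qed

text \<open>Harmonic numbers are unbounded, so comparison with zeta values fails for this factor.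
  The crude bound by \<open>n\<close> costs one power of the denominator, hence the exponent
  \<open>q + 1\<close>.\<close>

lemma S_quad_1_sums:
  assumes "2 \<le> b" "2 \<le> q"
  shows "(\<lambda>n. zeta_partial (Suc n) 1 * zeta_partial (Suc n) b / real (Suc n) ^ (q + 1))
    sums S_quad 1 b (q + 1)"
  unfolding S_quad_def
proof (rule summable_sums[OF summable_comparison_test'[where N = 0]])
  show "summable (\<lambda>n. zeta b * (1 / real (Suc n) ^ q))"
    using zeta_sums[OF assms(2)] by (intro summable_mult) (simp add: sums_iff)
  fix n
  have "zeta_partial (Suc n) 1 * zeta_partial (Suc n) b \<le> real (Suc n) * zeta b"
    by (intro mult_mono zeta_partial_le zeta_partial_le_zeta zeta_partial_nonneg assms) simp
  then have "zeta_partial (Suc n) 1 * zeta_partial (Suc n) b / real (Suc n) ^ (q + 1)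
      \<le> real (Suc n) * zeta b / real (Suc n) ^ (q + 1)"
    by (intro divide_right_mono) auto
  also have "\<dots> = zeta b * (1 / real (Suc n) ^ q)"
    by (simp del: of_nat_Suc)
  finally show "norm (zeta_partial (Suc n) 1 * zeta_partial (Suc n) b / real (Suc n) ^ (q + 1))
      \<le> zeta b * (1 / real (Suc n) ^ q)"
    by (simp add: zeta_partial_nonneg abs_mult)
qed

section \<open>Partial fractions in \<open>k\<close> and the evaluation of
  \<open>shifted_sum\<close>\<close>

text \<open>Induction on \<open>q\<close>, dividing by \<open>k\<close> at each step. The simple
  poles at \<open>0\<close> and \<open>-n\<close> have opposite coefficients; they are kept together
  as a difference because only the difference is summable over \<open>k\<close>.\<close>

lemma partial_fraction:
  fixes n k :: real
  assumes "n > 0" "k > 0"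
  shows "1 / (k ^ q * (n + k)\<^sup>2) =
      (\<Sum>s = 2..q. real (s - 1) * (-1) ^ s / n ^ s * (1 / k ^ (q + 2 - s)))
      + (-1) ^ (q + 1) * real q / n ^ (q + 1) * (1 / k - 1 / (n + k))
      + (-1) ^ q / n ^ q * (1 / (n + k)\<^sup>2)"
proof (induction q)
  case (Suc q)
  have nz: "n \<noteq> 0" "k \<noteq> 0" "n + k \<noteq> 0"
    using assms by auto
  let ?T = "\<lambda>q s. real (s - 1) * (-1) ^ s / n ^ s * (1 / k ^ (q + 2 - s))"
  have S: "(\<Sum>s = 2..Suc q. ?T (Suc q) s)
      = (\<Sum>s = 2..q. ?T q s) / k + real q * (-1) ^ (q + 1) / n ^ (q + 1) * (1 / k\<^sup>2)"
  proof -
    have "(\<Sum>s = 2..q. ?T (Suc q) s) = (\<Sum>s = 2..q. ?T q s / k)"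
      by (intro sum.cong) (auto simp: Suc_diff_le)
    then show ?thesis
      \<comment> \<open>For \<open>q = 0\<close> both ranges are empty and the additional term has
        the factor \<open>0\<close>.\<close>
      by (cases "q = 0") (simp_all add: sum_divide_distrib numeral_2_eq_2)
  qed
  \<comment> \<open>The term \<open>1 / k\<^sup>2\<close> from \<open>e1\<close> supplies the new
    summand \<open>s = Suc q\<close>. The coefficient of the difference grows from \<open>q\<close>
    to \<open>q + 1\<close>: \<open>e1\<close> carries over \<open>q\<close>, and \<open>e2\<close>
    adds one.\<close>
  have e1: "(1 / k - 1 / (n + k)) / k = 1 / k\<^sup>2 - (1 / k - 1 / (n + k)) / n"
    using nz by (simp add: divide_simps power2_eq_square)
  have e2: "1 / (n + k)\<^sup>2 / k = ((1 / k - 1 / (n + k)) / n - 1 / (n + k)\<^sup>2) / n"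
    using nz by (simp add: divide_simps) algebra
  have "1 / (k ^ Suc q * (n + k)\<^sup>2) = 1 / (k ^ q * (n + k)\<^sup>2) / k"
    by (simp add: field_simps)
  also have "\<dots> = (\<Sum>s = 2..q. ?T q s) / k
      + (-1) ^ (q + 1) * real q / n ^ (q + 1) * ((1 / k - 1 / (n + k)) / k)
      + (-1) ^ q / n ^ q * (1 / (n + k)\<^sup>2 / k)"
    by (subst Suc.IH) (simp only: add_divide_distrib times_divide_eq_right)
  also have "\<dots> = (\<Sum>s = 2..Suc q. ?T (Suc q) s)
      + (-1) ^ (Suc q + 1) * real (Suc q) / n ^ (Suc q + 1) * (1 / k - 1 / (n + k))
      + (-1) ^ Suc q / n ^ Suc q * (1 / (n + k)\<^sup>2)"
  proof -
    \<comment> \<open>With these quantities opaque, the identity is linear in them and only powers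
      of \<open>n\<close> remain as denominators.\<close>
    define t u v w where "t = (\<Sum>s = 2..q. ?T q s) / k" and "u = 1 / k - 1 / (n + k)"
      and "v = 1 / (n + k)\<^sup>2" and "w = 1 / k\<^sup>2"
    show ?thesis
      unfolding e1 e2 S unfolding t_def[symmetric] u_def[symmetric] v_def[symmetric] w_def[symmetric]
      using nz(1) by (simp add: field_simps)
  qed
  finally show ?case .
qed simp

text \<open>Raising \<open>n\<close> by one adds a telescoping series with sum
  \<open>1 / real (Suc n)\<close>.\<close>

lemma harmonic_sums:
  "(\<lambda>k. 1 / real (Suc k) - 1 / real (n + Suc k)) sums zeta_partial n 1"
proof (induction n)
  case (Suc n)
  have "(\<lambda>k. 1 / real (k + Suc n)) \<longlonglongrightarrow> 0"
    using LIMSEQ_ignore_initial_segment[OF lim_1_over_n[where 'a = real], of "Suc n"] by simp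
  from telescope_sums'[OF this]
  have "(\<lambda>k. 1 / real (n + Suc k) - 1 / real (Suc n + Suc k)) sums (1 / real (Suc n))"
    by (simp add: add_ac)
  from sums_add[OF Suc this] show ?case
    by (simp add: zeta_partial_Suc)
qed simp

lemma zeta_tail_sums:
  assumes "2 \<le> s"
  shows "(\<lambda>k. 1 / real (n + Suc k) ^ s) sums (zeta s - zeta_partial n s)"
  using sums_split_initial_segment[OF zeta_sums[OF assms], of n]
  by (simp add: zeta_partial_eq_sum_lessThan add_ac)

text \<open>Partial fractions summed termwise over \<open>k\<close>: \<open>s \<le> q\<close> keeps
  the exponents \<open>q + 2 - s\<close> at least 2, the difference of simple poles gives a harmonic
  number, and the double pole gives a tail of \<open>zeta 2\<close>.\<close>

lemma shifted_sum_sums: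
  assumes "n > 0"
  shows "(\<lambda>k. 1 / (real (Suc k) ^ q * (real (n + Suc k))\<^sup>2)) sums
      ((\<Sum>s = 2..q. real (s - 1) * (-1) ^ s / real n ^ s * zeta (q + 2 - s))
      + (-1) ^ (q + 1) * real q / real n ^ (q + 1) * zeta_partial n 1
      + (-1) ^ q / real n ^ q * (zeta 2 - zeta_partial n 2))"
proof -
  have "(\<lambda>k. 1 / (real (Suc k) ^ q * (real (n + Suc k))\<^sup>2)) =
     (\<lambda>k. (\<Sum>s = 2..q. real (s - 1) * (-1) ^ s / real n ^ s * (1 / real (Suc k) ^ (q + 2 - s)))
      + (-1) ^ (q + 1) * real q / real n ^ (q + 1) * (1 / real (Suc k) - 1 / real (n + Suc k))
      + (-1) ^ q / real n ^ q * (1 / (real (n + Suc k))\<^sup>2))"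
    using partial_fraction[of "real n" "real (Suc k)" q for k] assms
    by (simp only: of_nat_add of_nat_0_less_iff zero_less_Suc)
  then show ?thesis
    by (simp only:) (intro sums_add sums_sum sums_mult zeta_sums harmonic_sums zeta_tail_sums; auto)
qed

text \<open>Each term of the closed form of \<open>shifted_sum\<close>, multiplied by
  \<open>zeta_partial (Suc n) p\<close>, sums over \<open>n\<close> to an Euler sum. The weight
  \<open>real (s - 1)\<close> stays in front to match \<open>sum_sum_antidiagonal\<close>.\<close>

lemma zeta_partial_shifted_sums:
  assumes "2 \<le> p" "2 \<le> q"
  shows "(\<lambda>n. zeta_partial (Suc n) p * shifted_sum q (Suc n)) sums
     ((\<Sum>s = 2..q. real (s - 1) * ((-1) ^ s * zeta (q + 2 - s) * S_lin p s))
      + (-1) ^ (q + 1) * real q * S_quad 1 p (q + 1)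
      + (-1) ^ q * (zeta 2 * S_lin p q - S_quad 2 p q))"
proof -
  have "zeta_partial (Suc n) p * shifted_sum q (Suc n) =
     (\<Sum>s = 2..q. real (s - 1) * ((-1) ^ s * zeta (q + 2 - s)
          * (zeta_partial (Suc n) p / real (Suc n) ^ s)))
      + (-1) ^ (q + 1) * real q
          * (zeta_partial (Suc n) 1 * zeta_partial (Suc n) p / real (Suc n) ^ (q + 1))
      + (-1) ^ q * (zeta 2 * (zeta_partial (Suc n) p / real (Suc n) ^ q)
          - zeta_partial (Suc n) 2 * zeta_partial (Suc n) p / real (Suc n) ^ q)" for n
    unfolding shifted_sum_def sums_unique[OF shifted_sum_sums[OF zero_less_Suc], symmetric]
      distrib_left sum_distrib_left
    by (intro arg_cong2[of _ _ _ _ "(+)"] sum.cong refl)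
      (simp_all add: algebra_simps diff_divide_distrib del: of_nat_Suc power_Suc)
  then show ?thesis
    using assms
    by (simp only:) (intro sums_add sums_diff sums_sum sums_mult S_lin_sums S_quad_sums S_quad_1_sums; simp)
qed

section \<open>Reordering of nonnegative series (Tonelli) and the symmetry in \<open>p\<close> and
  \<open>q\<close>\<close>

lemma suminf_ennreal_commute:
  fixes f :: "nat \<Rightarrow> nat \<Rightarrow> ennreal"
  shows "(\<Sum>i. \<Sum>j. f i j) = (\<Sum>j. \<Sum>i. f i j)"
  using nn_integral_suminf[of f "count_space UNIV"]
  by (simp add: nn_integral_count_space_nat)

lemma suminf_ennreal_from:
  fixes g :: "nat \<Rightarrow> ennreal"
  shows "(\<Sum>n. if j \<le> n then g n else 0) = (\<Sum>n. g (n + j))"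
  using suminf_offset[of "\<lambda>n. if j \<le> n then g n else 0" j] by simp

text \<open>Summing over \<open>n\<close> innermost turns the constraint \<open>j \<le> n\<close>
  into the shift from \<open>n\<close> to \<open>n + j\<close>. The inner series then depends on
  \<open>j + k\<close> alone, which exposes the symmetry. Working in \<open>ennreal\<close> frees
  the interchanges from summability conditions.\<close>

lemma ennreal_zeta_partial_shifted_suminf:
  "(\<Sum>n. ennreal (zeta_partial (Suc n) p * shifted_sum q (Suc n))) =
    (\<Sum>j. \<Sum>k. ennreal (1 / real (Suc j) ^ p) * ennreal (1 / real (Suc k) ^ q)
        * (\<Sum>n. ennreal (1 / (real (Suc (Suc (n + j + k))))\<^sup>2)))"
proof -
  let ?a = "\<lambda>j. ennreal (1 / real (Suc j) ^ p)"
  let ?b = "\<lambda>k. ennreal (1 / real (Suc k) ^ q)"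
  let ?g = "\<lambda>n. ennreal (1 / (real (Suc (Suc n)))\<^sup>2)"
  \<comment> \<open>The finite sum becomes a full series with a cutoff, so that its range no longer
    depends on \<open>n\<close> when the sums are exchanged.\<close>
  have 1: "ennreal (zeta_partial (Suc n) p) = (\<Sum>j. if j \<le> n then ?a j else 0)" for n
  proof -
    have "(\<Sum>j. if j \<le> n then ?a j else 0) = (\<Sum>j<Suc n. if j \<le> n then ?a j else 0)"
      by (rule suminf_finite) auto
    also have "\<dots> = (\<Sum>j<Suc n. ?a j)"
      by (rule sum.cong) auto
    also have "\<dots> = ennreal (zeta_partial (Suc n) p)"
      unfolding zeta_partial_eq_sum_lessThan by (rule sum_ennreal) simp
    finally show ?thesis by simp
  qed
  have 2: "ennreal (shifted_sum q (Suc n)) = (\<Sum>k. ?b k * ?g (n + k))" for n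
  proof -
    have "ennreal (shifted_sum q (Suc n))
        = (\<Sum>k. ennreal (1 / (real (Suc k) ^ q * (real (Suc n + Suc k))\<^sup>2)))"
      unfolding shifted_sum_def
      by (intro suminf_ennreal2[symmetric] sums_summable[OF shifted_sum_sums]) auto
    also have "\<dots> = (\<Sum>k. ?b k * ?g (n + k))"
      by (simp add: ennreal_mult[symmetric] del: of_nat_Suc)
    finally show ?thesis .
  qed
  have "(\<Sum>n. ennreal (zeta_partial (Suc n) p * shifted_sum q (Suc n)))
      = (\<Sum>n. (\<Sum>j. if j \<le> n then ?a j else 0) * (\<Sum>k. ?b k * ?g (n + k)))"
    by (simp only: ennreal_mult'[OF zeta_partial_nonneg] 1 2)
  also have "\<dots> = (\<Sum>n. \<Sum>j. \<Sum>k. if j \<le> n then ?a j * (?b k * ?g (n + k)) else 0)"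
    unfolding ennreal_suminf_multc[symmetric]
    by (intro suminf_cong) (auto simp: ennreal_suminf_cmult)
  also have "\<dots> = (\<Sum>j. \<Sum>k. \<Sum>n. if j \<le> n then ?a j * (?b k * ?g (n + k)) else 0)"
    \<comment> \<open>The sum over \<open>n\<close> moves first past \<open>j\<close>, then past
      \<open>k\<close>.\<close>
    by (subst suminf_ennreal_commute) (intro suminf_cong suminf_ennreal_commute)
  also have "\<dots> = (\<Sum>j. \<Sum>k. ?a j * ?b k * (\<Sum>n. ?g (n + j + k)))"
    unfolding suminf_ennreal_from by (simp only: ennreal_suminf_cmult mult.assoc)
  finally show ?thesis .
qed

text \<open>Exchanging the roles of \<open>j\<close> and \<open>k\<close> in the reordered series
  exchanges \<open>p\<close> and \<open>q\<close>. The equality returns to the reals because both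
  series have nonnegative terms and converge.\<close>

lemma zeta_partial_shifted_suminf_swap:
  assumes "2 \<le> p" "2 \<le> q"
  shows "(\<Sum>n. zeta_partial (Suc n) p * shifted_sum q (Suc n))
    = (\<Sum>n. zeta_partial (Suc n) q * shifted_sum p (Suc n))"
proof -
  have nonneg: "0 \<le> shifted_sum r (Suc n)" for r n
    unfolding shifted_sum_def by (intro suminf_nonneg sums_summable[OF shifted_sum_sums]) auto
  have "(\<Sum>n. ennreal (zeta_partial (Suc n) p * shifted_sum q (Suc n)))
      = (\<Sum>n. ennreal (zeta_partial (Suc n) q * shifted_sum p (Suc n)))"
    unfolding ennreal_zeta_partial_shifted_suminf
    by (subst suminf_ennreal_commute) (simp only: ac_simps)
  then show ?thesis
    using assms nonneg zeta_partial_nonneg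
    by (simp add: suminf_ennreal2 suminf_nonneg sums_summable[OF zeta_partial_shifted_sums])
qed

section \<open>Summation along antidiagonals and the final comparison\<close>

text \<open>A value \<open>s = i + j\<close> comes from exactly \<open>s - 1\<close> pairs of
  positive integers. In the induction each row \<open>i\<close> gains the one term on the new
  antidiagonal.\<close>

lemma sum_sum_antidiagonal:
  fixes g :: "nat \<Rightarrow> real"
  shows "(\<Sum>i = 1..q - 1. \<Sum>j = 1..q - i. g (i + j)) = (\<Sum>s = 2..q. real (s - 1) * g s)"
proof (induction q)
  case (Suc q)
  show ?case
  proof (cases q)
    case (Suc r)
    have "(\<Sum>j = 1..Suc q - i. g (i + j)) = (\<Sum>j = 1..q - i. g (i + j)) + g (Suc q)"
      if "i \<in> {1..q}" for i
      using that by (simp add: Suc_diff_le)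
    then have "(\<Sum>i = 1..q. \<Sum>j = 1..Suc q - i. g (i + j))
        = (\<Sum>i = 1..q. \<Sum>j = 1..q - i. g (i + j)) + real q * g (Suc q)"
      by (simp add: sum.distrib)
    also have "(\<Sum>i = 1..q. \<Sum>j = 1..q - i. g (i + j))
        = (\<Sum>i = 1..q - 1. \<Sum>j = 1..q - i. g (i + j))"
      \<comment> \<open>The row \<open>i = q\<close> is empty and drops out.\<close>
      unfolding Suc by simp
    also note Suc.IH
    finally show ?thesis
      using Suc by simp
  qed simp
qed simp

theorem theorem3p2:
  fixes p m :: nat
  assumes "p \<ge> 2"
  shows "(-1) ^ (p - 1) * (S_quad 2 (p + 2 * m) p - S_quad 2 p (p + 2 * m))
    = (\<Sum>i = 1..p + 2 * m - 1. \<Sum>j = 1..p + 2 * m - i.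
         (-1) ^ (i + j) * zeta (p + 2 * m + 2 - i - j) * S_lin p (i + j))
    - (\<Sum>i = 1..p - 1. \<Sum>j = 1..p - i.
         (-1) ^ (i + j) * zeta (p + 2 - i - j) * S_lin (p + 2 * m) (i + j))
    - (-1) ^ (p - 1) * zeta 2 * (S_lin p (p + 2 * m) - S_lin (p + 2 * m) p)
    + (-1) ^ (p - 1) * real (p + 2 * m) * S_quad 1 p (p + 2 * m + 1)
    - (-1) ^ (p - 1) * real p * S_quad 1 (p + 2 * m) (p + 1)"
proof -
  define q where "q = p + 2 * m"
  have q: "2 \<le> q" using assms by (simp add: q_def)
  define \<epsilon> :: real where "\<epsilon> = (-1) ^ (p - 1)"
  \<comment> \<open>\<open>p\<close> and \<open>q\<close> have the same parity, so one sign serves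
    both evaluations.\<close>
  have sign: "(-1) ^ p = - \<epsilon>" "(-1) ^ q = - \<epsilon>" "(-1) ^ (p + 1) = \<epsilon>" "(-1) ^ (q + 1) = \<epsilon>"
    using assms by (cases p; simp add: \<epsilon>_def q_def power_add power_mult)+
  have "(\<Sum>s = 2..q. real (s - 1) * ((-1) ^ s * zeta (q + 2 - s) * S_lin p s))
      + \<epsilon> * real q * S_quad 1 p (q + 1) - \<epsilon> * (zeta 2 * S_lin p q - S_quad 2 p q)
    = (\<Sum>s = 2..p. real (s - 1) * ((-1) ^ s * zeta (p + 2 - s) * S_lin q s))
      + \<epsilon> * real p * S_quad 1 q (p + 1) - \<epsilon> * (zeta 2 * S_lin q p - S_quad 2 q p)"
    using zeta_partial_shifted_suminf_swap[OF assms q]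
      zeta_partial_shifted_sums[OF assms q] zeta_partial_shifted_sums[OF q assms]
    unfolding sums_iff sign by simp
  then show ?thesis
    \<comment> \<open>\<open>diff_diff_left\<close> turns \<open>q + 2 - i - j\<close> into
      \<open>q + 2 - (i + j)\<close>, making each summand a function of
      \<open>i + j\<close>.\<close>
    unfolding q_def[symmetric] \<epsilon>_def[symmetric] diff_diff_left
      sum_sum_antidiagonal[of "\<lambda>s. (-1) ^ s * zeta (q + 2 - s) * S_lin p s" q]
      sum_sum_antidiagonal[of "\<lambda>s. (-1) ^ s * zeta (p + 2 - s) * S_lin q s" p]
    by (simp add: algebra_simps)
qed

end
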